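(* Let $A$ be an abelian group generated by two elements $a,b$, and let $\varphi,\psi:A\to S_n$ be homomorphisms that are generator-conjugate with respect to $a,b$ and satisfy $\varphi(a)=\psi(a)=\sigma$. Write $\sigma=\sigma_1\cdots\sigma_l$, where $\sigma_i$ is the product of all the cycles of length $d_i$ in the disjoint cycle decomposition of $\sigma$ and $d_1,\dots,d_l\geq 2$ are distinct. Then $\varphi,\psi$ are conjugate if and only if they are element-conjugate on restriction to $S_{\mathbf{Fix}(\sigma)}$ and on restriction to $\mathrm{Cent}_0(\sigma_i)$ for each $1\le i\le l$; that is, if and only if the component homomorphisms $\varphi_0,\psi_0:A\to S_{\mathbf{Fix}(\sigma)}$ are element-conjugate in $S_{\mathbf{Fix}(\sigma)}$ and, for each $1\le i\le l$, the component homomorphisms $\varphi_i,\psi_i:A\to\mathrm{Cent}_0(\sigma_i)\subseteq S_{X_{\sigma_i}}$ are element-conjugate as homomorphisms to the symmetric group $S_{X_{\sigma_i}}$.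
   Context: $S_n$ is the symmetric group of $\{1,\dots,n\}$ and $S_X$ that of a set $X$; for $X\subseteq\{1,\dots,n\}$, $S_X$ is regarded as a subgroup of $S_n$. $\mathbf{Fix}(\sigma)$ is the set of fixed points of $\sigma$ and $X_\sigma=\{1,\dots,n\}\setminus\mathbf{Fix}(\sigma)$. $\mathrm{Cent}_0(\sigma)$ denotes the centralizer of $\sigma$ in $S_{X_\sigma}$. Homomorphisms $\varphi,\psi:G\to H$ are generator-conjugate with respect to generators $g_1,\dots,g_r$ of $G$ if for each $i$ there is $h\in H$ (depending on $i$) with $h\varphi(g_i)h^{-1}=\psi(g_i)$. They are element-conjugate if for every $g\in G$ there is $h\in H$ (depending on $g$) with $h\varphi(g)h^{-1}=\psi(g)$. They are conjugate if there is a single $h\in H$ with $h\varphi(g)h^{-1}=\psi(g)$ for all $g\in G$. Since $A$ is abelian, the images of $\varphi$ and $\psi$ lie in $\mathrm{Cent}_{S_n}(\sigma)=S_{\mathbf{Fix}(\sigma)}\times\mathrm{Cent}_0(\sigma_1)\times\cdots\times\mathrm{Cent}_0(\sigma_l)$. The component homomorphisms $\varphi_0,\varphi_1,\dots,\varphi_l$ (resp. $\psi_0,\dots,\psi_l$) are the compositions of $\varphi$ (resp. $\psi$) with the projections onto these factors; these are the restrictions of $\varphi$ (resp. $\psi$) to $S_{\mathbf{Fix}(\sigma)}$ and to $\mathrm{Cent}_0(\sigma_i)$. *)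

theory Defs
  imports "HOL-Algebra.Sym_Groups" "HOL-Combinatorics.Orbits" "HOL-Library.Disjoint_Sets"
begin

text \<open>Conjugacy relations between homomorphisms \<open>\<phi>, \<psi> : G \<rightarrow> H\<close>.\<close>

definition generator_conjugate ::
    "('h, 'n) monoid_scheme \<Rightarrow> 'g set \<Rightarrow> ('g \<Rightarrow> 'h) \<Rightarrow> ('g \<Rightarrow> 'h) \<Rightarrow> bool" where
  "generator_conjugate H S \<phi> \<psi> \<longleftrightarrow>
     (\<forall>g\<in>S. \<exists>h\<in>carrier H. h \<otimes>\<^bsub>H\<^esub> \<phi> g \<otimes>\<^bsub>H\<^esub> inv\<^bsub>H\<^esub> h = \<psi> g)"

definition element_conjugate ::
    "('g, 'm) monoid_scheme \<Rightarrow> ('h, 'n) monoid_scheme \<Rightarrow> ('g \<Rightarrow> 'h) \<Rightarrow> ('g \<Rightarrow> 'h) \<Rightarrow> bool" where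
  "element_conjugate G H \<phi> \<psi> \<longleftrightarrow>
     (\<forall>g\<in>carrier G. \<exists>h\<in>carrier H. h \<otimes>\<^bsub>H\<^esub> \<phi> g \<otimes>\<^bsub>H\<^esub> inv\<^bsub>H\<^esub> h = \<psi> g)"

definition conjugate_homs ::
    "('g, 'm) monoid_scheme \<Rightarrow> ('h, 'n) monoid_scheme \<Rightarrow> ('g \<Rightarrow> 'h) \<Rightarrow> ('g \<Rightarrow> 'h) \<Rightarrow> bool" where
  "conjugate_homs G H \<phi> \<psi> \<longleftrightarrow>
     (\<exists>h\<in>carrier H. \<forall>g\<in>carrier G. h \<otimes>\<^bsub>H\<^esub> \<phi> g \<otimes>\<^bsub>H\<^esub> inv\<^bsub>H\<^esub> h = \<psi> g)"


text \<open>
  The symmetric group \<open>S\<^sub>X\<close>. Its elements are permutations of the whole type that fix every point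
  outside \<open>X\<close>, so for \<open>X \<subseteq> {1..n}\<close> its carrier is literally a subset of that of \<open>sym_group n\<close>.
\<close>

definition sym_group_on :: "'a set \<Rightarrow> ('a \<Rightarrow> 'a) monoid" where
  "sym_group_on X = \<lparr> carrier = {p. p permutes X}, mult = (\<circ>), one = id \<rparr>"

lemma sym_group_on_atLeastAtMost: "sym_group_on {1..n} = sym_group n"
  by (simp add: sym_group_on_def sym_group_def)

lemma group_sym_group_on: "group (sym_group_on X)"
  unfolding sym_group_on_def using permutes_inv permutes_inv_o(2)
  by (auto intro!: groupI simp add: permutes_compose permutes_id comp_assoc) blast

definition Fix :: "nat \<Rightarrow> (nat \<Rightarrow> nat) \<Rightarrow> nat set" where
  "Fix n \<sigma> = {x \<in> {1..n}. \<sigma> x = x}"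

definition moved :: "nat \<Rightarrow> (nat \<Rightarrow> nat) \<Rightarrow> nat set" where
  "moved n \<sigma> = {1..n} - Fix n \<sigma>"


definition perm_prod :: "('a \<Rightarrow> 'a) list \<Rightarrow> 'a \<Rightarrow> 'a" where
  "perm_prod ps = foldr (\<circ>) ps id"

text \<open>
  A cycle is given by the list of its points. Distinctness of the concatenation says both that each
  list is repetition-free and that different cycles are disjoint; cycles of length one are omitted.
\<close>

definition disjoint_cycle_decomposition :: "'a list list \<Rightarrow> ('a \<Rightarrow> 'a) \<Rightarrow> bool" where
  "disjoint_cycle_decomposition cs \<sigma> \<longleftrightarrow>
     distinct (concat cs) \<and> (\<forall>c\<in>set cs. 2 \<le> length c) \<and> \<sigma> = perm_prod (map cycle_of_list cs)"

definition cycles_of_length :: "'a list list \<Rightarrow> nat \<Rightarrow> 'a \<Rightarrow> 'a" where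
  "cycles_of_length cs d = perm_prod (map cycle_of_list (filter (\<lambda>c. length c = d) cs))"


text \<open>
  The component of \<open>\<phi>\<close> on \<open>X\<close>. If the values of \<open>\<phi>\<close> lie in an internal direct product of subgroups
  of groups \<open>S\<^sub>X\<close> for pairwise disjoint sets \<open>X\<close>, then this is \<open>\<phi>\<close> followed by the projection
  onto the factor belonging to \<open>X\<close>, by the lemma \<open>perm_restrict_perm_prod\<close> below.
\<close>

definition component :: "('g \<Rightarrow> 'a \<Rightarrow> 'a) \<Rightarrow> 'a set \<Rightarrow> 'g \<Rightarrow> 'a \<Rightarrow> 'a" where
  "component \<phi> X g = perm_restrict (\<phi> g) X"

lemma perm_restrict_perm_prod:
  assumes "distinct is" "disjoint_family_on X (set is)" "\<forall>i\<in>set is. f i permutes X i" "j \<in> set is"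
  shows "perm_restrict (perm_prod (map f is)) (X j) = f j"
proof -
  have outside: "perm_prod (map f ks) x = x"
    if "\<forall>k\<in>set ks. f k permutes X k \<and> x \<notin> X k" for ks x
    using that by (induction ks) (auto simp: perm_prod_def permutes_def)
  have "perm_prod (map f is) x = f j x" if x: "x \<in> X j" for x
    using assms
  proof (induction "is")
    case Nil
    then show ?case by simp
  next
    case (Cons i ks)
    show ?case
    proof (cases "i = j")
      case True
      have "x \<notin> X k" if "k \<in> set ks" for k
        using that True Cons.prems(1,2) x by (auto simp: disjoint_family_on_def)
      then show ?thesis
        using outside[of ks x] Cons.prems(3) True by (auto simp: perm_prod_def)
    next
      case False
      then have "perm_prod (map f ks) x = f j x"
        using Cons.prems by (intro Cons.IH) (auto simp: disjoint_family_on_def)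
      moreover have "f j x \<in> X j"
        using Cons.prems(3,4) x permutes_in_image[of "f j" "X j" x] by blast
      then have "f j x \<notin> X i"
        using False Cons.prems(2,4) by (auto simp: disjoint_family_on_def)
      ultimately show ?thesis
        using Cons.prems(3) permutes_not_in[of "f i" "X i" "f j x"] by (simp add: perm_prod_def)
    qed
  qed
  moreover have "f j permutes X j" using assms by blast
  ultimately show ?thesis
    by (auto simp: fun_eq_iff perm_restrict_def permutes_not_in)
qed

end

theory Submission
  imports Defs
begin

text \<open>
  The idea is to count fixed points. As \<open>A\<close> is abelian, all values of \<open>\<phi>\<close> and \<open>\<psi>\<close> commute
  with \<open>\<sigma>\<close>, so both actions preserve, for every \<open>e\<close>, the set of points that lie on a cycle of \<open>\<sigma>\<close>
  of length \<open>e\<close>. These sets are the blocks of the statement (\<open>e = 1\<close> gives the fixed points), and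
  they partition \<open>{1..n}\<close>. A permutation that conjugates \<open>\<phi>\<close> to \<open>\<psi>\<close> commutes with
  \<open>\<sigma> = \<phi> a = \<psi> a\<close>, hence preserves every block and conjugates the components, which gives one
  direction. Conversely, conjugating permutations of the blocks can be glued, so it is enough to find
  one on each block separately.

  On a block, element-conjugate components have the same number of fixed points for each \<open>g\<close>. For
  actions of an arbitrary group this does not make the actions isomorphic, as different
  combinations of orbits can have the same counts. What helps here is that all stabilizers on a block
  have the same intersection, generated by \<open>a\<^sup>e\<close>, with the subgroup generated by \<open>a\<close>. Take the least
  \<open>m > 0\<close> for which some \<open>a\<^sup>i b\<^sup>m\<close> has a fixed point \<open>x\<close> under \<open>\<phi>\<close>. Having the same count, this element
  also has a fixed point \<open>y\<close> under \<open>\<psi>\<close>, and \<open>m\<close> is least for \<open>\<psi>\<close> as well. By division with remainder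
  on the exponent of \<open>b\<close>, any subgroup that contains \<open>a\<^sup>i b\<^sup>m\<close> but no \<open>a\<^sup>k b\<^sup>j\<close> with \<open>0 < j < m\<close> is
  determined by its intersection with the powers of \<open>a\<close>
  (\<open>subgroup_le_if_same_minimal_element\<close>). So \<open>x\<close> and \<open>y\<close> have the same stabilizer, and their
  orbits are isomorphic. Removing both orbits leaves the counts equal, and induction on the number of
  points gives an equivariant bijection (\<open>equivariant_bij_if_card_fixed_points_eq\<close>).
\<close>

section \<open>Actions of a group and equivariant bijections\<close>

text \<open>
  The values \<open>\<phi> g\<close> are functions on the whole type, and only their behaviour on \<open>X\<close> matters. In
  this way a homomorphism to \<open>S\<^sub>n\<close> acts, without being restricted, on every invariant subset of
  \<open>{1..n}\<close>, and removing an orbit from \<open>X\<close> does not change \<open>\<phi>\<close>.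
\<close>

definition acts_on :: "('g, 'm) monoid_scheme \<Rightarrow> ('g \<Rightarrow> 'x \<Rightarrow> 'x) \<Rightarrow> 'x set \<Rightarrow> bool" where
  "acts_on A \<phi> X \<longleftrightarrow>
     (\<forall>x\<in>X. \<phi> \<one>\<^bsub>A\<^esub> x = x \<and>
       (\<forall>g\<in>carrier A. \<phi> g x \<in> X \<and> (\<forall>h\<in>carrier A. \<phi> (h \<otimes>\<^bsub>A\<^esub> g) x = \<phi> h (\<phi> g x))))"

definition fixed_points :: "('x \<Rightarrow> 'x) \<Rightarrow> 'x set \<Rightarrow> 'x set" where
  "fixed_points p X = {x \<in> X. p x = x}"

definition equivariant_bij ::
    "('g, 'm) monoid_scheme \<Rightarrow> ('g \<Rightarrow> 'x \<Rightarrow> 'x) \<Rightarrow> 'x set \<Rightarrow> ('g \<Rightarrow> 'y \<Rightarrow> 'y) \<Rightarrow> 'y set \<Rightarrow> ('x \<Rightarrow> 'y) \<Rightarrow> bool"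
  where "equivariant_bij A \<phi> X \<psi> Y f \<longleftrightarrow>
     bij_betw f X Y \<and> (\<forall>g\<in>carrier A. \<forall>x\<in>X. f (\<phi> g x) = \<psi> g (f x))"

lemma acts_on_simps:
  assumes "acts_on A \<phi> X" "x \<in> X"
  shows "\<phi> \<one>\<^bsub>A\<^esub> x = x"
    and "g \<in> carrier A \<Longrightarrow> \<phi> g x \<in> X"
    and "g \<in> carrier A \<Longrightarrow> h \<in> carrier A \<Longrightarrow> \<phi> (h \<otimes>\<^bsub>A\<^esub> g) x = \<phi> h (\<phi> g x)"
  using assms unfolding acts_on_def by auto

lemma acts_on_subset:
  assumes "acts_on A \<phi> X" "P \<subseteq> X"
    and "\<And>x g. x \<in> P \<Longrightarrow> g \<in> carrier A \<Longrightarrow> \<phi> g x \<in> P"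
  shows "acts_on A \<phi> P"
  using assms unfolding acts_on_def by (simp add: subset_iff)

lemma (in group) acts_on_inv:
  assumes "acts_on G \<phi> X" "x \<in> X" "g \<in> carrier G"
  shows "\<phi> (inv g) (\<phi> g x) = x" and "\<phi> g (\<phi> (inv g) x) = x"
  using acts_on_simps(1)[OF assms(1,2)] acts_on_simps(3)[OF assms(1,2), of g "inv g"]
    acts_on_simps(3)[OF assms(1,2), of "inv g" g] assms(3)
  by simp_all

lemma (in group) acts_on_eq_iff:
  assumes "acts_on G \<phi> X" "x \<in> X" "g \<in> carrier G" "h \<in> carrier G"
  shows "\<phi> g x = \<phi> h x \<longleftrightarrow> \<phi> (inv h \<otimes> g) x = x"
proof -
  have "\<phi> (inv h \<otimes> g) x = \<phi> (inv h) (\<phi> g x)"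
    using acts_on_simps(3)[OF assms(1,2,3), of "inv h"] assms(4) by simp
  moreover have "\<phi> h (\<phi> (inv h) (\<phi> g x)) = \<phi> g x"
    using acts_on_inv(2)[OF assms(1) acts_on_simps(2)[OF assms(1,2,3)] assms(4)] .
  moreover have "\<phi> (inv h) (\<phi> h x) = x"
    using acts_on_inv(1)[OF assms(1,2,4)] .
  ultimately show ?thesis by metis
qed

lemma (in group) subgroup_stabilizer:
  assumes "acts_on G \<phi> X" "x \<in> X"
  shows "subgroup {g \<in> carrier G. \<phi> g x = x} G"
proof
  show "inv g \<in> {g \<in> carrier G. \<phi> g x = x}" if "g \<in> {g \<in> carrier G. \<phi> g x = x}" for g
    using that acts_on_inv(1)[OF assms, of g] by auto
qed (use acts_on_simps[OF assms] in auto)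

text \<open>
  A bijection that intertwines \<open>p\<close> and \<open>q\<close> maps the fixed points of \<open>p\<close> onto those of \<open>q\<close>. Only a
  single pair of maps is involved, so this applies to element-conjugacy, where the bijection depends
  on the group element, as well as to equivariant bijections.
\<close>

lemma card_fixed_points_eq:
  assumes f: "bij_betw f X Y" and eq: "\<And>x. x \<in> X \<Longrightarrow> f (p x) = q (f x)"
    and p: "\<And>x. x \<in> X \<Longrightarrow> p x \<in> X"
  shows "card (fixed_points p X) = card (fixed_points q Y)"
proof -
  have "q (f x) = f x \<longleftrightarrow> p x = x" if "x \<in> X" for x
    using that eq p f by (metis bij_betw_imp_inj_on inj_on_eq_iff)
  then have "f ` fixed_points p X = fixed_points q Y"
    using f unfolding fixed_points_def bij_betw_def by force
  moreover have "inj_on f (fixed_points p X)"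
    using f unfolding fixed_points_def bij_betw_def by (auto intro: inj_on_subset)
  ultimately show ?thesis by (metis card_image)
qed

lemma (in comm_group) generate_pair:
  assumes "a \<in> carrier G" "b \<in> carrier G" "g \<in> generate G {a, b}"
  obtains i j :: int where "g = a [^] i \<otimes> b [^] j"
proof -
  have "\<exists>(i::int) (j::int). g = a [^] i \<otimes> b [^] j" using assms(3)
  proof induction
    case one
    show ?case using assms by (intro exI[of _ "0::int"]) simp
  next
    case (incl h)
    then consider "h = a" | "h = b" by blast
    then show ?case
    proof cases
      case 1
      then show ?thesis using assms by (intro exI[of _ "1::int"] exI[of _ "0::int"]) auto
    next
      case 2
      then show ?thesis using assms by (intro exI[of _ "0::int"] exI[of _ "1::int"]) auto
    qed
  next
    case (inv h)
    then consider "h = a" | "h = b" by blast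
    then show ?case
    proof cases
      case 1
      then show ?thesis using assms by (intro exI[of _ "-1::int"] exI[of _ "0::int"]) (auto simp: int_pow_neg)
    next
      case 2
      then show ?thesis using assms by (intro exI[of _ "0::int"] exI[of _ "-1::int"]) (auto simp: int_pow_neg)
    qed
  next
    case (eng g h)
    then obtain i j k l :: int where "g = a [^] i \<otimes> b [^] j" "h = a [^] k \<otimes> b [^] l" by blast
    then have "g \<otimes> h = a [^] (i + k) \<otimes> b [^] (j + l)"
      using assms by (simp add: int_pow_mult m_ac)
    then show ?case by blast
  qed
  then show thesis using that by blast
qed

text \<open>
  Division with remainder: given \<open>g = a\<^sup>p b\<^sup>q\<close> in \<open>S\<close>, dividing by the power of \<open>c = a\<^sup>i b\<^sup>m\<close> with exponent
  \<open>q div m\<close> leaves an element of \<open>S\<close> in which the exponent of \<open>b\<close> is \<open>q mod m\<close>. By minimality that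
  exponent is \<open>0\<close>, so the remainder is a power of \<open>a\<close>, and these are shared with \<open>T\<close>.
\<close>

lemma (in comm_group) subgroup_le_if_same_minimal_element:
  fixes i m :: int
  assumes gens: "a \<in> carrier G" "b \<in> carrier G" "generate G {a, b} = carrier G"
    and S: "subgroup S G" and T: "subgroup T G"
    and same: "\<And>k::int. a [^] k \<in> S \<Longrightarrow> a [^] k \<in> T"
    and c: "a [^] i \<otimes> b [^] m \<in> S" "a [^] i \<otimes> b [^] m \<in> T" and "m > 0"
    and min: "\<And>j k::int. 0 < j \<Longrightarrow> j < m \<Longrightarrow> a [^] k \<otimes> b [^] j \<notin> S"
  shows "S \<subseteq> T"
proof
  fix g assume g: "g \<in> S"
  define c where "c = a [^] i \<otimes> b [^] m"
  have cc: "c \<in> carrier G" using gens by (simp add: c_def)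
  have "g \<in> carrier G" using g subgroup.subset[OF S] by blast
  then obtain p q :: int where pq: "g = a [^] p \<otimes> b [^] q"
    using generate_pair gens by metis
  define r where "r = q div m"
  let ?k = "p - i * r"
  have "g = c [^] r \<otimes> (a [^] ?k \<otimes> b [^] (q mod m))"
  proof -
    have "c [^] r = a [^] (i * r) \<otimes> b [^] (m * r)"
      using gens by (simp add: c_def int_pow_distrib int_pow_pow)
    then have "c [^] r \<otimes> (a [^] ?k \<otimes> b [^] (q mod m)) =
        a [^] (i * r + ?k) \<otimes> b [^] (m * r + q mod m)"
      using gens by (simp only: int_pow_mult) (simp add: m_ac)
    also have "m * r + q mod m = q" by (simp add: r_def)
    finally show ?thesis using pq by simp
  qed
  then have g_eq: "g = c [^] r \<otimes> (a [^] ?k \<otimes> b [^] (q mod m))" .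
  have crS: "c [^] r \<in> S" and crT: "c [^] r \<in> T"
    using c S T by (auto simp: c_def intro: subgroup_int_pow_closed)
  have "a [^] ?k \<otimes> b [^] (q mod m) = inv (c [^] r) \<otimes> g"
    using gens cc by (simp add: g_eq m_assoc[symmetric])
  then have rem: "a [^] ?k \<otimes> b [^] (q mod m) \<in> S"
    using crS g S by (simp add: subgroup.m_closed subgroup.m_inv_closed)
  then have "q mod m = 0"
    using min[of "q mod m" ?k] pos_mod_bound[OF \<open>m > 0\<close>] pos_mod_sign[OF \<open>m > 0\<close>]
    by (metis order_le_less)
  then have "a [^] ?k \<in> S" using rem gens by simp
  then have "a [^] ?k \<otimes> b [^] (q mod m) \<in> T"
    using same \<open>q mod m = 0\<close> gens by simp
  then show "g \<in> T" using g_eq crT T by (metis subgroup.m_closed)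
qed

text \<open>
  Equality of the stabilizers is what makes \<open>\<phi> g x \<mapsto> \<psi> g y\<close> well defined and injective.
\<close>

lemma (in group) equivariant_bij_orbits:
  assumes X: "acts_on G \<phi> X" "x \<in> X" and Y: "acts_on G \<psi> Y" "y \<in> Y"
    and stab: "\<And>g. g \<in> carrier G \<Longrightarrow> \<phi> g x = x \<longleftrightarrow> \<psi> g y = y"
  obtains f where "equivariant_bij G \<phi> ((\<lambda>g. \<phi> g x) ` carrier G) \<psi> ((\<lambda>g. \<psi> g y) ` carrier G) f"
proof -
  have eq: "\<phi> g x = \<phi> h x \<longleftrightarrow> \<psi> g y = \<psi> h y" if "g \<in> carrier G" "h \<in> carrier G" for g h
    using that acts_on_eq_iff[OF X] acts_on_eq_iff[OF Y] stab by simp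
  define f where "f z = \<psi> (SOME g. g \<in> carrier G \<and> \<phi> g x = z) y" for z
  have f: "f (\<phi> g x) = \<psi> g y" if "g \<in> carrier G" for g
    unfolding f_def by (rule someI2[where a = g]) (use that eq in auto)
  have "inj_on f ((\<lambda>g. \<phi> g x) ` carrier G)"
    by (rule inj_onI) (auto simp: f eq)
  moreover have "f ` (\<lambda>g. \<phi> g x) ` carrier G = (\<lambda>g. \<psi> g y) ` carrier G"
    by (simp add: image_image f)
  moreover have "f (\<phi> g (\<phi> h x)) = \<psi> g (f (\<phi> h x))" if "g \<in> carrier G" "h \<in> carrier G" for g h
  proof -
    have "f (\<phi> g (\<phi> h x)) = f (\<phi> (g \<otimes> h) x)" using that acts_on_simps(3)[OF X] by simp
    also have "\<dots> = \<psi> g (\<psi> h y)" using that f acts_on_simps(3)[OF Y] by simp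
    finally show ?thesis using f that by simp
  qed
  ultimately have "equivariant_bij G \<phi> ((\<lambda>g. \<phi> g x) ` carrier G) \<psi> ((\<lambda>g. \<psi> g y) ` carrier G) f"
    by (auto simp: equivariant_bij_def bij_betw_def)
  then show thesis by (rule that)
qed

lemma (in group) acts_on_orbit:
  assumes "acts_on G \<phi> X" "x \<in> X"
  shows "(\<lambda>g. \<phi> g x) ` carrier G \<subseteq> X"
    and "acts_on G \<phi> ((\<lambda>g. \<phi> g x) ` carrier G)"
    and "acts_on G \<phi> (X - (\<lambda>g. \<phi> g x) ` carrier G)"
proof -
  note s = acts_on_simps[OF assms(1)]
  show sub: "(\<lambda>g. \<phi> g x) ` carrier G \<subseteq> X" using acts_on_simps(2)[OF assms] by auto
  have "\<phi> h (\<phi> g x) = \<phi> (h \<otimes> g) x" if "g \<in> carrier G" "h \<in> carrier G" for g h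
    using that s(3)[OF assms(2)] by simp
  then have orbit: "\<phi> h z \<in> (\<lambda>g. \<phi> g x) ` carrier G"
    if "z \<in> (\<lambda>g. \<phi> g x) ` carrier G" "h \<in> carrier G" for z h
    using that by auto
  show "acts_on G \<phi> ((\<lambda>g. \<phi> g x) ` carrier G)"
    using sub orbit by (intro acts_on_subset[OF assms(1)]) auto
  have "z \<in> (\<lambda>g. \<phi> g x) ` carrier G"
    if z: "z \<in> X" "h \<in> carrier G" "\<phi> h z \<in> (\<lambda>g. \<phi> g x) ` carrier G" for z h
  proof -
    obtain g where g: "g \<in> carrier G" "\<phi> h z = \<phi> g x" using z(3) by blast
    then have "z = \<phi> (inv h \<otimes> g) x"
      using acts_on_inv(1)[OF assms(1) z(1,2)] s(3)[OF assms(2)] z(2) by simp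
    moreover have "inv h \<otimes> g \<in> carrier G" using g(1) z(2) by simp
    ultimately show ?thesis by (rule image_eqI)
  qed
  then show "acts_on G \<phi> (X - (\<lambda>g. \<phi> g x) ` carrier G)"
    using s(2) by (intro acts_on_subset[OF assms(1)]) auto
qed

lemma equivariant_bij_Un:
  assumes f: "equivariant_bij A \<phi> P \<psi> Q f" and f': "equivariant_bij A \<phi> P' \<psi> Q' f'"
    and "acts_on A \<phi> P" "acts_on A \<phi> P'" "P \<inter> P' = {}" "Q \<inter> Q' = {}"
  shows "equivariant_bij A \<phi> (P \<union> P') \<psi> (Q \<union> Q') (\<lambda>x. if x \<in> P then f x else f' x)"
proof -
  have "bij_betw (\<lambda>x. if x \<in> P then f x else f' x) (P \<union> P') (Q \<union> Q')"
    using assms by (intro bij_betw_disjoint_Un) (auto simp: equivariant_bij_def)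
  moreover have "\<phi> g x \<in> P'" "\<phi> g x \<notin> P" if "x \<in> P'" "g \<in> carrier A" for g x
    using that acts_on_simps(2)[OF assms(4)] assms(5) by blast+
  moreover have "x \<notin> P" if "x \<in> P'" for x using that assms(5) by blast
  ultimately show ?thesis
    using f f' acts_on_simps(2)[OF assms(3)] unfolding equivariant_bij_def by auto
qed

text \<open>
  Equal counts alone do not suffice: for the Klein four-group, a regular orbit together with two fixed
  points has the same counts as three orbits of size two whose stabilizers are the three subgroups
  of order two. The assumption \<open>stab_a\<close> excludes such configurations.
\<close>

theorem (in comm_group) equivariant_bij_if_card_fixed_points_eq:
  assumes gens: "a \<in> carrier G" "b \<in> carrier G" "generate G {a, b} = carrier G"
    and "finite X" "finite Y" "acts_on G \<phi> X" "acts_on G \<psi> Y"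
    and stab_a: "\<And>x y (k::int). x \<in> X \<Longrightarrow> y \<in> Y \<Longrightarrow> \<phi> (a [^] k) x = x \<longleftrightarrow> \<psi> (a [^] k) y = y"
    and card_eq: "\<And>g. g \<in> carrier G \<Longrightarrow> card (fixed_points (\<phi> g) X) = card (fixed_points (\<psi> g) Y)"
  shows "\<exists>f. equivariant_bij G \<phi> X \<psi> Y f"
  using \<open>finite X\<close> \<open>finite Y\<close> \<open>acts_on G \<phi> X\<close> \<open>acts_on G \<psi> Y\<close> stab_a card_eq
proof (induction "card X" arbitrary: X Y rule: less_induct)
  case less
  note X = \<open>acts_on G \<phi> X\<close> and Y = \<open>acts_on G \<psi> Y\<close>
  show ?case
  proof (cases "X = {}")
    case True
    have "fixed_points (\<psi> \<one>) Y = Y"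
      using acts_on_simps(1)[OF Y] by (auto simp: fixed_points_def)
    then have "card Y = 0"
      using less.prems(6)[of \<one>] True by (simp add: fixed_points_def)
    then have "equivariant_bij G \<phi> X \<psi> Y (\<lambda>_. undefined)"
      using True \<open>finite Y\<close> by (simp add: equivariant_bij_def bij_betw_def)
    then show ?thesis by blast
  next
    case False
    have fix_iff: "fixed_points (\<phi> g) X = {} \<longleftrightarrow> fixed_points (\<psi> g) Y = {}" if "g \<in> carrier G" for g
    proof -
      have "finite (fixed_points (\<phi> g) X)" "finite (fixed_points (\<psi> g) Y)"
        using \<open>finite X\<close> \<open>finite Y\<close> by (simp_all add: fixed_points_def)
      then show ?thesis using less.prems(6)[OF that] by (metis card_0_eq)
    qed
    \<comment> \<open>Such \<open>m\<close> exist because the powers of \<open>b\<close> cannot move a point to infinitely many places.\<close>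
    let ?P = "\<lambda>m::nat. m > 0 \<and> (\<exists>i::int. fixed_points (\<phi> (a [^] i \<otimes> b [^] int m)) X \<noteq> {})"
    have "\<exists>m. ?P m"
    proof -
      obtain x where x: "x \<in> X" using False by blast
      have "(\<lambda>j::nat. \<phi> (b [^] int j) x) ` UNIV \<subseteq> X"
        using acts_on_simps(2)[OF X x] gens by auto
      then have "\<not> inj (\<lambda>j::nat. \<phi> (b [^] int j) x)"
        using \<open>finite X\<close> by (metis finite_imageD finite_subset infinite_UNIV_nat)
      then obtain j k :: nat where "j < k" "\<phi> (b [^] int j) x = \<phi> (b [^] int k) x"
        unfolding inj_def by (metis linorder_neqE_nat)
      then have "\<phi> (b [^] int (k - j)) x = x"
        using acts_on_eq_iff[OF X x, of "b [^] int k" "b [^] int j"] gens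
        by (simp add: of_nat_diff int_pow_diff m_comm)
      then have "?P (k - j)"
        using x gens \<open>j < k\<close> by (auto simp: fixed_points_def intro!: exI[of _ "0::int"])
      then show ?thesis ..
    qed
    define m where "m = (LEAST m. ?P m)"
    have "?P m" unfolding m_def by (rule LeastI_ex) fact
    then obtain i :: int where m: "m > 0" and i: "fixed_points (\<phi> (a [^] i \<otimes> b [^] int m)) X \<noteq> {}"
      by blast
    have min: "fixed_points (\<phi> (a [^] k \<otimes> b [^] j)) X = {}" "fixed_points (\<psi> (a [^] k \<otimes> b [^] j)) Y = {}"
      if "0 < j" "j < int m" for k j :: int
    proof -
      have "nat j < m" using that by linarith
      then have "\<not> ?P (nat j)" unfolding m_def by (rule not_less_Least)
      then show "fixed_points (\<phi> (a [^] k \<otimes> b [^] j)) X = {}" using that by auto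
      then show "fixed_points (\<psi> (a [^] k \<otimes> b [^] j)) Y = {}" using fix_iff gens by simp
    qed
    obtain x where x: "x \<in> X" "\<phi> (a [^] i \<otimes> b [^] int m) x = x"
      using i by (auto simp: fixed_points_def)
    obtain y where y: "y \<in> Y" "\<psi> (a [^] i \<otimes> b [^] int m) y = y"
    proof -
      have "fixed_points (\<psi> (a [^] i \<otimes> b [^] int m)) Y \<noteq> {}" using i fix_iff gens by simp
      then show thesis using that unfolding fixed_points_def by blast
    qed
    \<comment> \<open>By the choice of \<open>m\<close>, both stabilizers meet the hypotheses of the division argument, in either order.\<close>
    let ?S = "{g \<in> carrier G. \<phi> g x = x}" and ?T = "{g \<in> carrier G. \<psi> g y = y}"
    have S: "subgroup ?S G" and T: "subgroup ?T G"
      using subgroup_stabilizer[OF X x(1)] subgroup_stabilizer[OF Y y(1)] by auto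
    have "?S \<subseteq> ?T"
      by (rule subgroup_le_if_same_minimal_element[OF gens S T, of i "int m"])
        (use x y gens m min less.prems(5)[OF x(1) y(1)] in \<open>auto simp: fixed_points_def\<close>)
    moreover have "?T \<subseteq> ?S"
      by (rule subgroup_le_if_same_minimal_element[OF gens T S, of i "int m"])
        (use x y gens m min less.prems(5)[OF x(1) y(1)] in \<open>auto simp: fixed_points_def\<close>)
    ultimately have "\<phi> g x = x \<longleftrightarrow> \<psi> g y = y" if "g \<in> carrier G" for g
      using that by blast
    define P where "P = (\<lambda>g. \<phi> g x) ` carrier G"
    define Q where "Q = (\<lambda>g. \<psi> g y) ` carrier G"
    obtain f where f: "equivariant_bij G \<phi> P \<psi> Q f"
      using equivariant_bij_orbits[OF X x(1) Y y(1)] \<open>\<And>g. g \<in> carrier G \<Longrightarrow> \<phi> g x = x \<longleftrightarrow> \<psi> g y = y\<close>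
      unfolding P_def Q_def by blast
    have P: "P \<subseteq> X" "acts_on G \<phi> P" "acts_on G \<phi> (X - P)"
      using acts_on_orbit[OF X x(1)] by (auto simp: P_def)
    have Q: "Q \<subseteq> Y" "acts_on G \<psi> Q" "acts_on G \<psi> (Y - Q)"
      using acts_on_orbit[OF Y y(1)] by (auto simp: Q_def)
    have "x \<in> P" using acts_on_simps(1)[OF X x(1)] unfolding P_def by force
    have "\<exists>f'. equivariant_bij G \<phi> (X - P) \<psi> (Y - Q) f'"
    proof (rule less.hyps)
      show "card (X - P) < card X"
        using \<open>x \<in> P\<close> x(1) \<open>finite X\<close> by (intro psubset_card_mono) auto
      show "card (fixed_points (\<phi> g) (X - P)) = card (fixed_points (\<psi> g) (Y - Q))"
        if g: "g \<in> carrier G" for g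
      proof -
        have on_orbits: "card (fixed_points (\<phi> g) P) = card (fixed_points (\<psi> g) Q)"
          using f g acts_on_simps(2)[OF P(2)]
          by (intro card_fixed_points_eq[of f]) (auto simp: equivariant_bij_def)
        have diff: "fixed_points (\<phi> g) (X - P) = fixed_points (\<phi> g) X - fixed_points (\<phi> g) P"
          "fixed_points (\<psi> g) (Y - Q) = fixed_points (\<psi> g) Y - fixed_points (\<psi> g) Q"
          by (auto simp: fixed_points_def)
        have sub: "fixed_points (\<phi> g) P \<subseteq> fixed_points (\<phi> g) X" "fixed_points (\<psi> g) Q \<subseteq> fixed_points (\<psi> g) Y"
          using P(1) Q(1) by (auto simp: fixed_points_def)
        have fin: "finite (fixed_points (\<phi> g) P)" "finite (fixed_points (\<psi> g) Q)"
          using P(1) Q(1) \<open>finite X\<close> \<open>finite Y\<close> by (auto simp: fixed_points_def intro: finite_subset)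
        show ?thesis
          using diff card_Diff_subset[OF fin(1) sub(1)] card_Diff_subset[OF fin(2) sub(2)]
            less.prems(6)[OF g] on_orbits by simp
      qed
    qed (use \<open>finite X\<close> \<open>finite Y\<close> P Q less.prems(5) in auto)
    then obtain f' where "equivariant_bij G \<phi> (X - P) \<psi> (Y - Q) f'" ..
    from equivariant_bij_Un[OF f this P(2,3)] have
      "equivariant_bij G \<phi> (P \<union> (X - P)) \<psi> (Q \<union> (Y - Q)) (\<lambda>x. if x \<in> P then f x else f' x)" by blast
    then show ?thesis using P(1) Q(1) by (auto simp: Un_absorb1)
  qed
qed

section \<open>Points on cycles of a given length\<close>

lemma perm_prod_fixes:
  assumes "\<And>p. p \<in> set ps \<Longrightarrow> p x = x"
  shows "perm_prod ps x = x"
  using assms by (induction ps) (auto simp: perm_prod_def)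

lemma perm_prod_disjoint_cycles_apply:
  assumes "distinct (concat cs)" "[] \<notin> set cs" "c \<in> set cs" "x \<in> set c"
  shows "perm_prod (map cycle_of_list cs) x = cycle_of_list c x"
proof -
  have "distinct cs" "disjoint_family_on set (set cs)"
    using assms(1,2) by (auto simp: distinct_concat_iff disjoint_family_on_def)
  then have "perm_restrict (perm_prod (map cycle_of_list cs)) (set c) = cycle_of_list c"
    using assms(3) cycle_permutes by (intro perm_restrict_perm_prod) auto
  then show ?thesis using assms(4) by (metis perm_restrict_simps(1))
qed

lemma cycle_funpow_fixes_iff:
  assumes "distinct c" "x \<in> set c"
  shows "(cycle_of_list c ^^ k) x = x \<longleftrightarrow> length c dvd k"
proof -
  obtain j where j: "j < length c" "x = c ! j" using assms(2) by (metis in_set_conv_nth)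
  have "(cycle_of_list c ^^ k) x = map (cycle_of_list c ^^ k) c ! j" using j by simp
  also have "\<dots> = c ! ((k + j) mod length c)"
    using cyclic_rotation[OF assms(1), of k] j by (simp add: nth_rotate)
  finally have "(cycle_of_list c ^^ k) x = c ! ((k + j) mod length c)" .
  moreover have "(k + j) mod length c < length c" using j by (intro mod_less_divisor) auto
  ultimately have "(cycle_of_list c ^^ k) x = x \<longleftrightarrow> (k + j) mod length c = j mod length c"
    using nth_eq_iff_index_eq[OF assms(1), of "(k + j) mod length c" j] j
    by simp
  also have "\<dots> \<longleftrightarrow> length c dvd k"
    using mod_eq_dvd_iff_nat[of j "k + j" "length c"] by simp
  finally show ?thesis .
qed

text \<open>
  The points on cycles of length \<open>e\<close>, described by the powers of \<open>\<sigma>\<close> alone. In this form invariance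
  under permutations that commute with \<open>\<sigma>\<close> is immediate, fixed points are the case \<open>e = 1\<close>, and the
  condition says directly which powers of \<open>\<sigma>\<close> lie in the stabilizer of the point.
\<close>

definition points_of_period :: "nat \<Rightarrow> (nat \<Rightarrow> nat) \<Rightarrow> nat \<Rightarrow> nat set" where
  "points_of_period n \<sigma> e = {x \<in> {1..n}. \<forall>k. (\<sigma> ^^ k) x = x \<longleftrightarrow> e dvd k}"

lemma points_of_period_inj:
  "x \<in> points_of_period n \<sigma> e \<Longrightarrow> x \<in> points_of_period n \<sigma> e' \<Longrightarrow> e = e'"
  unfolding points_of_period_def by (metis (mono_tags, lifting) dvd_antisym dvd_refl mem_Collect_eq)

lemma Fix_eq_points_of_period: "Fix n \<sigma> = points_of_period n \<sigma> 1"
proof -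
  have "(\<sigma> ^^ k) x = x" if "\<sigma> x = x" for k x using that by (induction k) auto
  then show ?thesis by (fastforce simp: Fix_def points_of_period_def dest: spec[of _ 1])
qed

lemma disjoint_cycle_decomposition_period:
  assumes "disjoint_cycle_decomposition cs \<sigma>" "c \<in> set cs" "x \<in> set c"
  shows "(\<sigma> ^^ k) x = x \<longleftrightarrow> length c dvd k"
proof -
  have dist: "distinct (concat cs)" and ne: "[] \<notin> set cs"
    using assms(1) by (auto simp: disjoint_cycle_decomposition_def)
  have "(\<sigma> ^^ k) x = (cycle_of_list c ^^ k) x \<and> (cycle_of_list c ^^ k) x \<in> set c"
  proof (induction k)
    case (Suc k)
    then show ?case
      using perm_prod_disjoint_cycles_apply[OF dist ne assms(2)] assms(1)
        permutes_in_image[OF cycle_permutes[of c], of "(cycle_of_list c ^^ k) x"]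
      by (simp add: disjoint_cycle_decomposition_def)
  qed (use assms(3) in simp)
  moreover have "distinct c" using dist assms(2) by (simp add: distinct_concat_iff)
  ultimately show ?thesis using cycle_funpow_fixes_iff assms(3) by metis
qed

lemma disjoint_cycle_decomposition_moved:
  assumes "disjoint_cycle_decomposition cs \<sigma>" "\<sigma> x \<noteq> x"
  obtains c where "c \<in> set cs" "x \<in> set c"
proof -
  have "\<exists>p\<in>set (map cycle_of_list cs). p x \<noteq> x"
    using assms perm_prod_fixes unfolding disjoint_cycle_decomposition_def by metis
  then obtain c where "c \<in> set cs" "cycle_of_list c x \<noteq> x" by auto
  then show thesis using that id_outside_supp by metis
qed

lemma cycles_of_length_moves_iff:
  assumes "disjoint_cycle_decomposition cs \<sigma>"
  shows "cycles_of_length cs e x \<noteq> x \<longleftrightarrow> (\<exists>c\<in>set cs. length c = e \<and> x \<in> set c)"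
proof
  assume "cycles_of_length cs e x \<noteq> x"
  then have "\<exists>p\<in>set (map cycle_of_list (filter (\<lambda>c. length c = e) cs)). p x \<noteq> x"
    using perm_prod_fixes unfolding cycles_of_length_def by metis
  then obtain c where "c \<in> set cs" "length c = e" "cycle_of_list c x \<noteq> x" by auto
  then show "\<exists>c\<in>set cs. length c = e \<and> x \<in> set c" using id_outside_supp by metis
next
  assume "\<exists>c\<in>set cs. length c = e \<and> x \<in> set c"
  then obtain c where c: "c \<in> set cs" "length c = e" "x \<in> set c" by blast
  have dist: "distinct (concat cs)" and len: "\<forall>c\<in>set cs. 2 \<le> length c"
    using assms by (auto simp: disjoint_cycle_decomposition_def)
  have "distinct (concat (filter (\<lambda>c. length c = e) cs))"
    using dist by (induction cs) auto
  then have "cycles_of_length cs e x = cycle_of_list c x"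
    unfolding cycles_of_length_def using c len
    by (intro perm_prod_disjoint_cycles_apply) auto
  moreover have "distinct c" "2 \<le> length c"
    using dist len c(1) by (auto simp: distinct_concat_iff)
  then have "cycle_of_list c x \<noteq> x" using cycle_funpow_fixes_iff[OF _ c(3), of 1] by auto
  ultimately show "cycles_of_length cs e x \<noteq> x" by simp
qed

lemma moved_cycles_of_length_eq_points_of_period:
  assumes \<sigma>: "disjoint_cycle_decomposition cs \<sigma>" and "2 \<le> e"
  shows "moved n (cycles_of_length cs e) = points_of_period n \<sigma> e"
proof -
  have "(\<exists>c\<in>set cs. length c = e \<and> x \<in> set c) \<longleftrightarrow> (\<forall>k. (\<sigma> ^^ k) x = x \<longleftrightarrow> e dvd k)" for x
  proof
    assume period: "\<forall>k. (\<sigma> ^^ k) x = x \<longleftrightarrow> e dvd k"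
    then have "\<sigma> x \<noteq> x" using \<open>2 \<le> e\<close> by (auto dest: spec[of _ 1])
    then obtain c where c: "c \<in> set cs" "x \<in> set c"
      using disjoint_cycle_decomposition_moved[OF \<sigma>] by metis
    then have "length c = e"
      using period disjoint_cycle_decomposition_period[OF \<sigma>] by (metis dvd_antisym dvd_refl)
    then show "\<exists>c\<in>set cs. length c = e \<and> x \<in> set c" using c by blast
  qed (use disjoint_cycle_decomposition_period[OF \<sigma>] in blast)
  then show ?thesis
    unfolding moved_def Fix_def points_of_period_def
    using cycles_of_length_moves_iff[OF \<sigma>, of e] by blast
qed

text \<open>
  A moved point is moved by one of the factors of \<open>\<sigma>\<close>, so its cycle has one of the lengths \<open>d i\<close>.
\<close>

lemma points_of_period_cover:
  assumes \<sigma>: "disjoint_cycle_decomposition cs \<sigma>" and "\<forall>i\<in>I. 2 \<le> d i"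
    and prod: "\<sigma> = perm_prod (map (\<lambda>i. cycles_of_length cs (d i)) is)" and "set is = I"
  shows "{1..n} = (\<Union>e\<in>insert 1 (d ` I). points_of_period n \<sigma> e)"
proof -
  have "x \<in> (\<Union>e\<in>insert 1 (d ` I). points_of_period n \<sigma> e)" if "x \<in> {1..n}" for x
  proof (cases "\<sigma> x = x")
    case True
    then have "x \<in> points_of_period n \<sigma> 1"
      using that unfolding Fix_eq_points_of_period[symmetric] by (simp add: Fix_def)
    then show ?thesis by blast
  next
    case False
    then have "\<exists>p\<in>set (map (\<lambda>i. cycles_of_length cs (d i)) is). p x \<noteq> x"
      using prod perm_prod_fixes by metis
    then obtain i where "i \<in> I" "cycles_of_length cs (d i) x \<noteq> x" using \<open>set is = I\<close> by auto
    then have "x \<in> points_of_period n \<sigma> (d i)"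
      using that assms(2) moved_cycles_of_length_eq_points_of_period[OF \<sigma>, of "d i" n]
      unfolding moved_def Fix_def by auto
    then show ?thesis using \<open>i \<in> I\<close> by blast
  qed
  moreover have "points_of_period n \<sigma> e \<subseteq> {1..n}" for e
    unfolding points_of_period_def by blast
  ultimately show ?thesis by blast
qed

lemma commuting_perm_preserves_period:
  assumes h: "h permutes {1..n}" and comm: "h \<circ> \<sigma> = \<sigma> \<circ> h" and x: "x \<in> points_of_period n \<sigma> e"
  shows "h x \<in> points_of_period n \<sigma> e"
proof -
  have "h ((\<sigma> ^^ k) y) = (\<sigma> ^^ k) (h y)" for k y
  proof (induction k)
    case (Suc k)
    then show ?case using fun_cong[OF comm, of "(\<sigma> ^^ k) y"] by simp
  qed simp
  then have "(\<sigma> ^^ k) (h x) = h x \<longleftrightarrow> (\<sigma> ^^ k) x = x" for k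
    using permutes_inj[OF h] by (metis inj_eq)
  then show ?thesis
    using x permutes_in_image[OF h, of x] by (simp add: points_of_period_def)
qed

lemma perm_restrict_permutes:
  assumes "p permutes S" "finite X" "\<And>x. x \<in> X \<Longrightarrow> p x \<in> X"
  shows "perm_restrict p X permutes X"
proof (rule bij_imp_permutes)
  have "inj_on p X" using assms(1) permutes_inj by (metis inj_on_subset subset_UNIV)
  then have "bij_betw p X X"
    using assms(2,3) endo_inj_surj[of X p] by (auto simp: bij_betw_def)
  then show "bij_betw (perm_restrict p X) X X"
    by (rule bij_betw_cong[THEN iffD1, rotated]) (simp add: perm_restrict_def)
qed (simp add: perm_restrict_def)

section \<open>From permutations to actions\<close>

text \<open>
  Writing conjugacy as \<open>h \<circ> p = q \<circ> h\<close> removes the inverse and turns a conjugating permutation into a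
  map that intertwines \<open>p\<close> and \<open>q\<close>; outside \<open>X\<close> all three permutations are the identity.
\<close>

lemma conjugation_sym_group_on_iff:
  assumes "h permutes X" "p permutes X" "q permutes X"
  shows "h \<otimes>\<^bsub>sym_group_on X\<^esub> p \<otimes>\<^bsub>sym_group_on X\<^esub> inv\<^bsub>sym_group_on X\<^esub> h = q \<longleftrightarrow>
    (\<forall>x\<in>X. h (p x) = q (h x))"
proof -
  let ?G = "sym_group_on X"
  interpret group ?G by (rule group_sym_group_on)
  have car: "h \<in> carrier ?G" "p \<in> carrier ?G" "q \<in> carrier ?G"
    using assms by (auto simp: sym_group_on_def)
  then have "h \<otimes>\<^bsub>?G\<^esub> p \<otimes>\<^bsub>?G\<^esub> inv\<^bsub>?G\<^esub> h = q \<longleftrightarrow> h \<otimes>\<^bsub>?G\<^esub> p = q \<otimes>\<^bsub>?G\<^esub> h"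
    by (metis inv_closed inv_solve_right m_closed)
  also have "\<dots> \<longleftrightarrow> (\<forall>x. h (p x) = q (h x))"
    by (auto simp: sym_group_on_def fun_eq_iff)
  also have "\<dots> \<longleftrightarrow> (\<forall>x\<in>X. h (p x) = q (h x))"
    using assms permutes_not_in by metis
  finally show ?thesis .
qed

lemma acts_on_if_hom_sym_group_on:
  assumes "group A" and hom: "\<phi> \<in> hom A (sym_group_on S)"
    and "\<And>g x. g \<in> carrier A \<Longrightarrow> x \<in> X \<Longrightarrow> \<phi> g x \<in> X"
  shows "acts_on A \<phi> X"
proof -
  have "\<phi> \<one>\<^bsub>A\<^esub> = id"
    using hom_one[OF hom assms(1) group_sym_group_on] by (simp add: sym_group_on_def)
  then show ?thesis
    using assms(3) hom_mult[OF hom] by (auto simp: acts_on_def sym_group_on_def)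
qed

text \<open>
  The stabilizer of a point of period \<open>e\<close> meets the powers of \<open>a\<close> in a set that depends on \<open>e\<close> only. This
  is the condition on stabilizers under which equal fixed point counts suffice.
\<close>

lemma stabilizer_int_pow_period:
  fixes k :: int
  assumes "group A" and hom: "\<phi> \<in> hom A (sym_group_on {1..n})" and "a \<in> carrier A"
    and x: "x \<in> points_of_period n (\<phi> a) e"
  shows "\<phi> (a [^]\<^bsub>A\<^esub> k) x = x \<longleftrightarrow> int e dvd k"
proof -
  interpret A: group A by fact
  have mem: "\<phi> g \<in> carrier (sym_group_on {1..n})" if "g \<in> carrier A" for g
    using hom that by (rule hom_in_carrier)
  have act: "acts_on A \<phi> {1..n}"
  proof (rule acts_on_if_hom_sym_group_on[OF \<open>group A\<close> hom])
    show "\<phi> g x \<in> {1..n}" if "g \<in> carrier A" "x \<in> {1..n}" for g x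
      using mem[OF that(1)] that(2) permutes_in_image[of "\<phi> g" "{1..n}" x]
      by (simp add: sym_group_on_def)
  qed
  have x1: "x \<in> {1..n}" using x by (simp add: points_of_period_def)
  have "\<phi> (a [^]\<^bsub>A\<^esub> m) = \<phi> a ^^ m" for m :: nat
  proof (induction m)
    case 0
    show ?case
      using hom_one[OF hom \<open>group A\<close> group_sym_group_on] by (simp add: sym_group_on_def)
  next
    case (Suc m)
    have "\<phi> (a [^]\<^bsub>A\<^esub> Suc m) = \<phi> (a [^]\<^bsub>A\<^esub> m) \<circ> \<phi> a"
      using hom_mult[OF hom A.nat_pow_closed[OF \<open>a \<in> carrier A\<close>] \<open>a \<in> carrier A\<close>, of m]
      by (simp add: sym_group_on_def)
    then show ?case by (simp only: Suc.IH funpow_Suc_right)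
  qed
  note pow = this
  have nat: "\<phi> (a [^]\<^bsub>A\<^esub> m) x = x \<longleftrightarrow> int e dvd int m" for m :: nat
    unfolding pow using x by (simp add: points_of_period_def)
  have inv: "\<phi> (inv\<^bsub>A\<^esub> g) x = x \<longleftrightarrow> \<phi> g x = x" if "g \<in> carrier A" for g
  proof
    show "\<phi> g x = x" if "\<phi> (inv\<^bsub>A\<^esub> g) x = x"
      using A.acts_on_inv(2)[OF act x1 \<open>g \<in> carrier A\<close>] that by simp
    show "\<phi> (inv\<^bsub>A\<^esub> g) x = x" if "\<phi> g x = x"
      using A.acts_on_inv(1)[OF act x1 \<open>g \<in> carrier A\<close>] that by simp
  qed
  show ?thesis
  proof (cases k rule: int_cases2)
    case (nonneg m)
    then show ?thesis using nat by (simp add: int_pow_int)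
  next
    case (nonpos m)
    then show ?thesis
      using nat[of m] inv[OF A.nat_pow_closed[OF \<open>a \<in> carrier A\<close>], of m] \<open>a \<in> carrier A\<close>
      by (simp add: A.int_pow_neg_int)
  qed
qed

section \<open>Conjugacy of homomorphisms with a common value\<close>

text \<open>
  The theorem in terms of periods, where the fixed points of \<open>\<sigma>\<close> are a block like any other.
\<close>

theorem conjugate_homs_iff_element_conjugate_on_points_of_period:
  assumes "comm_group A" and gens: "a \<in> carrier A" "b \<in> carrier A" "generate A {a, b} = carrier A"
    and \<phi>: "\<phi> \<in> hom A (sym_group n)" and \<psi>: "\<psi> \<in> hom A (sym_group n)"
    and a: "\<phi> a = \<sigma>" "\<psi> a = \<sigma>"
    and cover: "{1..n} = (\<Union>e\<in>E. points_of_period n \<sigma> e)"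
  shows "conjugate_homs A (sym_group n) \<phi> \<psi> \<longleftrightarrow>
    (\<forall>e\<in>E. let X = points_of_period n \<sigma> e in
      element_conjugate A (sym_group_on X) (component \<phi> X) (component \<psi> X))"
proof -
  interpret A: comm_group A by fact
  let ?B = "points_of_period n \<sigma>"
  note hom = \<phi>[folded sym_group_on_atLeastAtMost] \<psi>[folded sym_group_on_atLeastAtMost]
  have perm: "\<phi> g permutes {1..n}" "\<psi> g permutes {1..n}" if "g \<in> carrier A" for g
    using that hom_in_carrier[OF hom(1)] hom_in_carrier[OF hom(2)] by (auto simp: sym_group_on_def)
  have inv: "\<phi> g x \<in> ?B e" "\<psi> g x \<in> ?B e" if "g \<in> carrier A" "x \<in> ?B e" for g x e
  proof -
    have "\<phi> g \<circ> \<sigma> = \<sigma> \<circ> \<phi> g" "\<psi> g \<circ> \<sigma> = \<sigma> \<circ> \<psi> g"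
      using hom_mult[OF hom(1), of g a] hom_mult[OF hom(1), of a g]
        hom_mult[OF hom(2), of g a] hom_mult[OF hom(2), of a g]
        a gens(1) that(1) A.m_comm[of a g] by (auto simp: sym_group_on_def)
    then show "\<phi> g x \<in> ?B e" "\<psi> g x \<in> ?B e"
      using commuting_perm_preserves_period perm that by blast+
  qed
  have fin: "finite (?B e)" for e by (simp add: points_of_period_def)
  have comp: "component \<phi> (?B e) g permutes ?B e" "component \<psi> (?B e) g permutes ?B e"
    if "g \<in> carrier A" for g e
    unfolding component_def
    using inv that by (auto intro!: perm_restrict_permutes[OF _ fin] perm)
  have conj_iff: "conjugate_homs A (sym_group n) \<phi> \<psi> \<longleftrightarrow>
      (\<exists>h. h permutes {1..n} \<and> (\<forall>g\<in>carrier A. \<forall>x\<in>{1..n}. h (\<phi> g x) = \<psi> g (h x)))"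
  proof -
    have conj: "h \<otimes>\<^bsub>sym_group_on {1..n}\<^esub> \<phi> g \<otimes>\<^bsub>sym_group_on {1..n}\<^esub>
          inv\<^bsub>sym_group_on {1..n}\<^esub> h = \<psi> g \<longleftrightarrow>
        (\<forall>x\<in>{1..n}. h (\<phi> g x) = \<psi> g (h x))" if "g \<in> carrier A" "h permutes {1..n}" for g h
      by (rule conjugation_sym_group_on_iff[OF that(2) perm[OF that(1)]])
    have carrier: "h \<in> carrier (sym_group_on {1..n}) \<longleftrightarrow> h permutes {1..n}" for h
      by (simp add: sym_group_on_def)
    show ?thesis
      unfolding conjugate_homs_def sym_group_on_atLeastAtMost[symmetric] Bex_def carrier
      by (intro ex_cong1 conj_cong ball_cong refl conj)
  qed
  have elem_iff: "element_conjugate A (sym_group_on (?B e)) (component \<phi> (?B e)) (component \<psi> (?B e)) \<longleftrightarrow>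
      (\<forall>g\<in>carrier A. \<exists>h. h permutes ?B e \<and> (\<forall>x\<in>?B e. h (\<phi> g x) = \<psi> g (h x)))" for e
  proof -
    have conj: "h \<otimes>\<^bsub>sym_group_on (?B e)\<^esub> component \<phi> (?B e) g \<otimes>\<^bsub>sym_group_on (?B e)\<^esub>
          inv\<^bsub>sym_group_on (?B e)\<^esub> h = component \<psi> (?B e) g \<longleftrightarrow>
        (\<forall>x\<in>?B e. h (\<phi> g x) = \<psi> g (h x))" if "g \<in> carrier A" "h permutes ?B e" for g h
      unfolding conjugation_sym_group_on_iff[OF that(2) comp[OF that(1)]]
      using permutes_in_image[OF that(2)] by (simp add: component_def perm_restrict_def)
    have carrier: "h \<in> carrier (sym_group_on (?B e)) \<longleftrightarrow> h permutes ?B e" for h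
      by (simp add: sym_group_on_def)
    show ?thesis
      unfolding element_conjugate_def Bex_def carrier
      by (intro ball_cong ex_cong1 conj_cong refl conj)
  qed
  show ?thesis
  proof
    assume "conjugate_homs A (sym_group n) \<phi> \<psi>"
    then obtain h where h: "h permutes {1..n}"
      and eq: "\<And>g x. g \<in> carrier A \<Longrightarrow> x \<in> {1..n} \<Longrightarrow> h (\<phi> g x) = \<psi> g (h x)"
      unfolding conj_iff by blast
    have "h \<circ> \<sigma> = \<sigma> \<circ> h"
    proof
      show "(h \<circ> \<sigma>) x = (\<sigma> \<circ> h) x" for x
      proof (cases "x \<in> {1..n}")
        case True
        then show ?thesis using eq[OF gens(1)] a by simp
      next
        case False
        then show ?thesis
          using a permutes_not_in[OF h] permutes_not_in[OF perm(1)[OF gens(1)]] by simp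
      qed
    qed
    then have stable: "h x \<in> ?B e" if "x \<in> ?B e" for x e
      using commuting_perm_preserves_period[OF h _ that] by blast
    have "perm_restrict h (?B e) permutes ?B e" for e
      using perm_restrict_permutes[OF h fin] stable by blast
    moreover have "perm_restrict h (?B e) (\<phi> g x) = \<psi> g (perm_restrict h (?B e) x)"
      if "g \<in> carrier A" "x \<in> ?B e" for g x e
    proof -
      have "x \<in> {1..n}" using that(2) by (simp add: points_of_period_def)
      then show ?thesis using that(2) inv(1)[OF that] eq[OF that(1)] by (simp add: perm_restrict_def)
    qed
    ultimately show "\<forall>e\<in>E. let X = ?B e in
        element_conjugate A (sym_group_on X) (component \<phi> X) (component \<psi> X)"
      unfolding Let_def elem_iff by blast
  next
    assume elem: "\<forall>e\<in>E. let X = ?B e in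
        element_conjugate A (sym_group_on X) (component \<phi> X) (component \<psi> X)"
    have "\<exists>f. equivariant_bij A \<phi> (?B e) \<psi> (?B e) f" if "e \<in> E" for e
    proof (rule A.equivariant_bij_if_card_fixed_points_eq[OF gens fin fin])
      show "acts_on A \<phi> (?B e)" "acts_on A \<psi> (?B e)"
        using inv by (auto intro!: acts_on_if_hom_sym_group_on[OF A.is_group] hom)
      show "\<phi> (a [^]\<^bsub>A\<^esub> k) x = x \<longleftrightarrow> \<psi> (a [^]\<^bsub>A\<^esub> k) y = y"
        if "x \<in> ?B e" "y \<in> ?B e" for x y and k :: int
        using stabilizer_int_pow_period[OF A.is_group hom(1) gens(1), of x e k]
          stabilizer_int_pow_period[OF A.is_group hom(2) gens(1), of y e k] that a by simp
      show "card (fixed_points (\<phi> g) (?B e)) = card (fixed_points (\<psi> g) (?B e))"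
        if g: "g \<in> carrier A" for g
      proof -
        obtain h where "h permutes ?B e" "\<forall>x\<in>?B e. h (\<phi> g x) = \<psi> g (h x)"
          using elem \<open>e \<in> E\<close> g unfolding Let_def elem_iff by blast
        then show ?thesis
          using inv g by (intro card_fixed_points_eq[of h]) (auto intro: permutes_imp_bij)
      qed
    qed
    then obtain f where f: "\<And>e. e \<in> E \<Longrightarrow> equivariant_bij A \<phi> (?B e) \<psi> (?B e) (f e)" by metis
    \<comment> \<open>The blocks are disjoint and exhaust \<open>{1..n}\<close>, so the bijections of the blocks glue to a permutation.\<close>
    define h where "h x = (if x \<in> {1..n} then f (THE e. x \<in> ?B e) x else x)" for x
    have h: "h x = f e x" if "x \<in> ?B e" for x e
    proof -
      have "(THE e. x \<in> ?B e) = e"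
        by (rule the_equality[where P = "\<lambda>e. x \<in> ?B e", OF that points_of_period_inj[OF _ that]])
      then show ?thesis using that by (simp add: h_def points_of_period_def)
    qed
    have "bij_betw h (\<Union>e\<in>E. ?B e) (\<Union>e\<in>E. ?B e)"
    proof (rule bij_betw_UNION_disjoint)
      show "disjoint_family_on ?B E"
        unfolding disjoint_family_on_def using points_of_period_inj by (metis disjoint_iff)
      show "bij_betw h (?B e) (?B e)" if "e \<in> E" for e
        using f[OF that] bij_betw_cong[of "?B e" h "f e", OF h] by (simp add: equivariant_bij_def)
    qed
    then have "h permutes {1..n}"
      using cover by (intro bij_imp_permutes) (auto simp: h_def)
    moreover have "h (\<phi> g x) = \<psi> g (h x)" if g: "g \<in> carrier A" and x: "x \<in> {1..n}" for g x
    proof -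
      obtain e where e: "e \<in> E" "x \<in> ?B e" using x cover by blast
      then show ?thesis
        using f[OF e(1)] g by (simp add: h[OF e(2)] h[OF inv(1)[OF g e(2)]] equivariant_bij_def)
    qed
    ultimately show "conjugate_homs A (sym_group n) \<phi> \<psi>" unfolding conj_iff by blast
  qed
qed

theorem corollary3p6:
  fixes A :: "('a, 'm) monoid_scheme" and a b :: 'a and n l :: nat
    and \<phi> \<psi> :: "'a \<Rightarrow> nat \<Rightarrow> nat" and \<sigma> :: "nat \<Rightarrow> nat"
    and cs :: "nat list list" and d :: "nat \<Rightarrow> nat"
  assumes "comm_group A"
    and "a \<in> carrier A" and "b \<in> carrier A" and "generate A {a, b} = carrier A"
    and "\<phi> \<in> hom A (sym_group n)" and "\<psi> \<in> hom A (sym_group n)"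
    and "generator_conjugate (sym_group n) {a, b} \<phi> \<psi>"
    and "\<phi> a = \<sigma>" and "\<psi> a = \<sigma>"
    and "disjoint_cycle_decomposition cs \<sigma>"
    and "inj_on d {1..l}" and "\<forall>i\<in>{1..l}. 2 \<le> d i"
    and "\<sigma> = perm_prod (map (\<lambda>i. cycles_of_length cs (d i)) [1..<Suc l])"
  shows "conjugate_homs A (sym_group n) \<phi> \<psi> \<longleftrightarrow>
    element_conjugate A (sym_group_on (Fix n \<sigma>))
      (component \<phi> (Fix n \<sigma>)) (component \<psi> (Fix n \<sigma>)) \<and>
    (\<forall>i\<in>{1..l}. let X = moved n (cycles_of_length cs (d i)) in
      element_conjugate A (sym_group_on X) (component \<phi> X) (component \<psi> X))"
proof -
  have "{1..n} = (\<Union>e\<in>insert 1 (d ` {1..l}). points_of_period n \<sigma> e)"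
    using assms(10,12,13) by (rule points_of_period_cover) auto
  note main = conjugate_homs_iff_element_conjugate_on_points_of_period[OF assms(1-6,8,9) this]
  have "moved n (cycles_of_length cs (d i)) = points_of_period n \<sigma> (d i)" if "i \<in> {1..l}" for i
    using that assms(10,12) by (intro moved_cycles_of_length_eq_points_of_period) auto
  then show ?thesis
    unfolding main Fix_eq_points_of_period Let_def by simp
qed

end
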